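(* For every integer $r\ge 2$ there exist a real number $\varepsilon=\varepsilon(r)>0$ and an integer $d_0=d_0(r)$ with the following property. For every integer $d\ge d_0$ there is a finite point set $P\subset\mathbb{R}^d$ of diameter $1$ such that for every coloring of the elements of $P$ with fewer than $(1+\varepsilon)^{\sqrt{d}}$ colors, there exist $r$ points of $P$ of the same color, any two of which are at (Euclidean) distance $1$.
   Context: The diameter of a finite point set is the largest Euclidean distance between two of its points. *)

theory Defs
  imports "HOL-Analysis.Analysis"
begin

text \<open>
  The dimension is quantified inside the statement, so it cannot be a type. The space
  \<open>\<real>\<^sup>d\<close> is \<^term>\<open>topspace (Euclidean_space d)\<close>: its points are the functions
  \<^typ>\<open>nat \<Rightarrow> real\<close> that vanish at all indices \<open>i \<ge> d\<close>.
\<close>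

definition edist :: "nat \<Rightarrow> (nat \<Rightarrow> real) \<Rightarrow> (nat \<Rightarrow> real) \<Rightarrow> real" where
  "edist d x y = L2_set (\<lambda>i. x i - y i) {..<d}"

text \<open>\<^const>\<open>Max\<close> is only meaningful here for finite nonempty \<open>P\<close>.\<close>

definition ediameter :: "nat \<Rightarrow> (nat \<Rightarrow> real) set \<Rightarrow> real" where
  "ediameter d P = Max {edist d x y | x y. x \<in> P \<and> y \<in> P}"

end

theory Submission
  imports Defs
begin

text \<open>
  Identify \<open>{1, -1}\<^sup>n\<close>, \<open>n = 2\<^sup>a\<close>, with the subsets of an \<open>n\<close>-element set; two sign vectors are
  orthogonal iff the symmetric difference of the sets has \<open>n/2\<close> elements. As in the Kahn--Kalai
  construction, the map \<open>v \<mapsto> v \<otimes> v / (n \<surd>2)\<close> into dimension \<open>n\<^sup>2 \<le> d < 4 n\<^sup>2\<close> turns orthogonality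
  into the maximal distance 1, so it suffices that every family of at least \<open>(2 c)\<^sup>n\<close> sets contains
  \<open>r\<close> members at pairwise distance \<open>n/2\<close>, for some \<open>c = c(r) < 1\<close>.

  This goes by induction on \<open>r\<close>. A Frankl--Wilson argument modulo \<open>q = 2\<^sup>k\<close> shows that a dense
  family has two members at distance \<open>n/2\<close>. Applying it to unions of blocks of a large constant
  size \<open>b\<close>, for which there are only \<open>2\<^bsup>n/b\<^esup>\<close> differences \<open>s\<close>, one finds a single \<open>s\<close> with
  \<open>|s| = n/2\<close> such that \<open>X = {A \<in> F. A \<triangle> s \<in> F}\<close> is still dense. Match the elements of \<open>s\<close>
  with those outside \<open>s\<close>. Any union of matched pairs has distance exactly \<open>n/2\<close> from \<open>s\<close>,
  so a clique found by induction (with \<open>n/2\<close> in place of \<open>n\<close>) in the trace of \<open>X\<close> on a coset of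
  such unions extends by the \<open>s\<close>-translate of one of its members.
\<close>

section \<open>Set families avoiding half distance\<close>

lemma even_binomial_two_power:
  assumes "0 < j" "j < 2 ^ k"
  shows "even (2 ^ k choose j)"
proof (rule ccontr)
  assume "odd (2 ^ k choose j)"
  then have "coprime (2 ^ k) (2 ^ k choose j)"
    by simp
  moreover have "j * (2 ^ k choose j) = 2 ^ k * ((2 ^ k - 1) choose (j - 1))"
    using assms times_binomial_minus1_eq[of j "2 ^ k"] by simp
  then have "2 ^ k dvd j * (2 ^ k choose j)"
    by simp
  ultimately have "2 ^ k dvd j"
    by (simp add: coprime_dvd_mult_left_iff)
  with assms show False
    by (auto dest: dvd_imp_le)
qed

text \<open>In the Vandermonde expansion every term except \<open>j = i\<close> has an even factor,
  so the parity of \<open>s choose i\<close> has period \<open>2 ^ k\<close> in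
  \<open>s\<close>.\<close>

lemma even_binomial_add_two_power:
  assumes "i < 2 ^ k"
  shows "even ((s + 2 ^ k) choose i) \<longleftrightarrow> even (s choose i)"
proof -
  have "((s + 2 ^ k) choose i) = (\<Sum>j\<le>i. (s choose j) * (2 ^ k choose (i - j)))"
    by (rule vandermonde[symmetric])
  also have "\<dots> = (s choose i) + (\<Sum>j<i. (s choose j) * (2 ^ k choose (i - j)))"
    by (simp add: lessThan_Suc_atMost[symmetric])
  finally show ?thesis
    using assms by (auto intro!: dvd_sum dvd_mult even_binomial_two_power)
qed

text \<open>Periodicity reduces to \<open>s < 2 ^ k\<close>, where the truncated sum is the whole
  row sum \<open>2 ^ s\<close>, odd only for \<open>s = 0\<close>. This lets divisibility by
  \<open>2 ^ k\<close> be tested over the two-element field.\<close>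

lemma odd_sum_binomial_iff:
  "odd (\<Sum>i<2 ^ k. s choose i) \<longleftrightarrow> 2 ^ k dvd s"
proof (induction s rule: less_induct)
  case (less s)
  show ?case
  proof (cases "s < 2 ^ k")
    case True
    have "(\<Sum>i<2 ^ k. s choose i) = (\<Sum>i\<le>s. s choose i)"
      using True by (intro sum.mono_neutral_right) auto
    also have "\<dots> = 2 ^ s"
      by (rule choose_row_sum)
    finally show ?thesis
      using True by (auto dest: dvd_imp_le)
  next
    case False
    then obtain u where u: "s = u + 2 ^ k"
      by (metis add.commute le_Suc_ex not_less)
    have "even (\<Sum>i<2 ^ k. s choose i) \<longleftrightarrow> even (\<Sum>i<2 ^ k. u choose i)"
      unfolding u even_sum_iff[OF finite_lessThan]
      by (intro arg_cong[where f = even] arg_cong[where f = card])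
        (auto simp: even_binomial_add_two_power)
    then show ?thesis
      using less.IH[of u] u by simp
  qed
qed

lemma card_subsets_card_less:
  assumes "finite A"
  shows "card {J. J \<subseteq> A \<and> card J < m} = (\<Sum>i<m. card A choose i)"
proof -
  have "{J. J \<subseteq> A \<and> card J < m} = (\<Union>i<m. {J. J \<subseteq> A \<and> card J = i})"
    by auto
  also have "card \<dots> = (\<Sum>i<m. card {J. J \<subseteq> A \<and> card J = i})"
    using assms by (intro card_UN_disjoint) auto
  finally show ?thesis
    by (simp add: n_subsets assms)
qed

text \<open>A rank argument over the two-element field: the number of sets \<open>J\<close> of size
  below \<open>2 ^ k\<close> inside \<open>A \<inter> B\<close> is odd iff \<open>2 ^ k\<close>
  divides \<open>card (A \<inter> B)\<close>, which on \<open>F\<close> means \<open>A = B\<close>.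
  Hence the inclusion vectors of the members of \<open>F\<close>, indexed by such \<open>J\<close>,
  are linearly independent.\<close>

lemma Frankl_Wilson_two_power:
  assumes "finite U" "F \<subseteq> Pow U"
    and diag: "\<And>A. A \<in> F \<Longrightarrow> 2 ^ k dvd card A"
    and off: "\<And>A B. A \<in> F \<Longrightarrow> B \<in> F \<Longrightarrow> A \<noteq> B \<Longrightarrow> \<not> 2 ^ k dvd card (A \<inter> B)"
  shows "card F \<le> (\<Sum>i<2 ^ k. card U choose i)"
proof -
  define I where "I = {J. J \<subseteq> U \<and> card J < 2 ^ k}"
  \<comment> \<open>\<open>\<phi> S\<close> is the support of the sum modulo 2 of the inclusion
    vectors of the members of \<open>S\<close>. Its injectivity expresses linear independence and
    allows plain counting of power sets.\<close>
  define \<phi> where "\<phi> S = {J \<in> I. odd (card {A \<in> S. J \<subseteq> A})}" for S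
  have fin: "finite I" "finite F"
    using assms by (auto simp: I_def intro: finite_subset[of F "Pow U"])
  have mem: "B \<in> S \<longleftrightarrow> odd (card {J \<in> \<phi> S. J \<subseteq> B})" if "S \<subseteq> F" "B \<in> F" for S B
  proof -
    have finS: "finite S"
      using that fin finite_subset by blast
    have I_Int: "card {J \<in> I. J \<subseteq> B \<and> J \<subseteq> A} = (\<Sum>i<2 ^ k. card (A \<inter> B) choose i)" if "A \<in> S" for A
    proof -
      have "A \<subseteq> U" "B \<subseteq> U"
        using that \<open>S \<subseteq> F\<close> \<open>B \<in> F\<close> assms(2) by auto
      then have "{J \<in> I. J \<subseteq> B \<and> J \<subseteq> A} = {J. J \<subseteq> A \<inter> B \<and> card J < 2 ^ k}"
        by (auto simp: I_def)
      moreover have "finite (A \<inter> B)"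
        using \<open>A \<subseteq> U\<close> assms(1) finite_subset by blast
      ultimately show ?thesis
        by (simp only: card_subsets_card_less)
    qed
    have "2 ^ k dvd card (A \<inter> B) \<longleftrightarrow> A = B" if "A \<in> S" for A
      using diag[of B] off[of A B] that \<open>S \<subseteq> F\<close> \<open>B \<in> F\<close> by auto
    then have single: "{A \<in> S. 2 ^ k dvd card (A \<inter> B)} = (if B \<in> S then {B} else {})"
      by auto
    \<comment> \<open>Pairing \<open>\<phi> S\<close> with the inclusion vector of \<open>B\<close>
      counts, modulo 2, the pairs \<open>(J, A)\<close> with
      \<open>J \<subseteq> A \<inter> B\<close>; only \<open>A = B\<close> contributes.\<close>
    have "even (card {J \<in> \<phi> S. J \<subseteq> B}) \<longleftrightarrow> even (\<Sum>J\<in>{J \<in> I. J \<subseteq> B}. card {A \<in> S. J \<subseteq> A})"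
      using fin by (subst even_sum_iff)
        (auto simp: \<phi>_def intro!: arg_cong[where f = even] arg_cong[where f = card])
    also have "(\<Sum>J\<in>{J \<in> I. J \<subseteq> B}. card {A \<in> S. J \<subseteq> A})
        = (\<Sum>A\<in>S. card {J \<in> {J \<in> I. J \<subseteq> B}. J \<subseteq> A})"
      using fin finS sum.swap_restrict[of "{J \<in> I. J \<subseteq> B}" S "\<lambda>_ _. 1::nat" "\<lambda>J A. J \<subseteq> A"]
      by simp
    also have "\<dots> = (\<Sum>A\<in>S. \<Sum>i<2 ^ k. card (A \<inter> B) choose i)"
      using I_Int by (intro sum.cong) simp_all
    also have "even \<dots> \<longleftrightarrow> even (card {A \<in> S. 2 ^ k dvd card (A \<inter> B)})"
      using finS by (subst even_sum_iff) (simp_all add: odd_sum_binomial_iff)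
    finally show ?thesis
      unfolding single by (auto split: if_splits)
  qed
  have "inj_on \<phi> (Pow F)"
  proof (rule inj_onI)
    fix S T assume "S \<in> Pow F" "T \<in> Pow F" "\<phi> S = \<phi> T"
    then show "S = T"
      using mem[of S] mem[of T] by (auto 0 4)
  qed
  then have "card (Pow F) \<le> card (Pow I)"
    using fin by (intro card_inj_on_le[of \<phi>]) (auto simp: \<phi>_def)
  then have "card F \<le> card I"
    using fin by (simp add: card_Pow)
  then show ?thesis
    using assms(1) by (simp add: I_def card_subsets_card_less)
qed

section \<open>Averaging over translates and the half-distance bound\<close>

text \<open>For fixed \<open>T\<close>, \<open>sym_diff g (w T)\<close> runs once through
  \<open>Pow U\<close> as \<open>g\<close> does. So there are \<open>card D * card F\<close> good
  pairs \<open>(g, T)\<close>, and some \<open>g\<close> attains the average. Thus \<open>F\<close>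
  keeps its density on a translate of a small subfamily.\<close>

lemma exists_dense_translate:
  fixes w :: "'i \<Rightarrow> 'a set"
  assumes "finite U" "finite D" "F \<subseteq> Pow U" "\<And>T. T \<in> D \<Longrightarrow> w T \<subseteq> U"
  obtains g where "g \<subseteq> U" "card D * card F \<le> card {T \<in> D. sym_diff g (w T) \<in> F} * 2 ^ card U"
proof -
  let ?n = "\<lambda>g. card {T \<in> D. sym_diff g (w T) \<in> F}"
  have "(\<Sum>g\<in>Pow U. ?n g) = (\<Sum>T\<in>D. card {g \<in> Pow U. sym_diff g (w T) \<in> F})"
    using sum.swap_restrict[of "Pow U" D "\<lambda>_ _. 1::nat" "\<lambda>g T. sym_diff g (w T) \<in> F"] assms
    by simp
  also have "\<dots> = (\<Sum>T\<in>D. card F)"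
  proof (intro sum.cong refl)
    fix T assume T: "T \<in> D"
    have cancel: "sym_diff (sym_diff g (w T)) (w T) = g" for g
      by blast
    have sub: "sym_diff g (w T) \<subseteq> U" if "g \<subseteq> U" for g
      using that assms(4)[OF T] by blast
    have "bij_betw (\<lambda>g. sym_diff g (w T)) {g \<in> Pow U. sym_diff g (w T) \<in> F} F"
    proof (rule bij_betw_byWitness[where f' = "\<lambda>g. sym_diff g (w T)"])
      show "(\<lambda>g. sym_diff g (w T)) ` F \<subseteq> {g \<in> Pow U. sym_diff g (w T) \<in> F}"
        using assms(3) by (intro image_subsetI CollectI conjI PowI sub) (auto simp only: cancel)
    qed (auto simp only: cancel)
    then show "card {g \<in> Pow U. sym_diff g (w T) \<in> F} = card F"
      by (rule bij_betw_same_card)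
  qed
  finally have sum: "(\<Sum>g\<in>Pow U. ?n g) = card D * card F"
    by simp
  have "\<exists>g\<in>Pow U. card D * card F \<le> ?n g * 2 ^ card U"
  proof (rule ccontr)
    assume "\<not> ?thesis"
    then have "(\<Sum>g\<in>Pow U. ?n g * 2 ^ card U) < (\<Sum>g\<in>Pow U. card D * card F)"
      using assms(1) by (intro sum_strict_mono) (auto simp: not_le)
    then show False
      using assms(1) by (simp add: sum_distrib_right[symmetric] sum card_Pow)
  qed
  then show ?thesis
    using that by auto
qed

lemma card_sym_diff:
  assumes "finite A" "finite B"
  shows "card (sym_diff A B) + 2 * card (A \<inter> B) = card A + card B"
proof -
  have "card A = card (A - B) + card (A \<inter> B)" "card B = card (B - A) + card (A \<inter> B)"
    using card_Diff_subset_Int[of A B] card_Diff_subset_Int[of B A] assms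
    by (auto simp: Int_commute card_mono)
  moreover have "card (sym_diff A B) = card (A - B) + card (B - A)"
    using assms by (intro card_Un_disjoint) auto
  ultimately show ?thesis
    by simp
qed

lemma card_subsets_containing:
  assumes "finite U" "u \<in> U"
  shows "card {A. A \<subseteq> U \<and> card A = Suc m \<and> u \<in> A} = (card U - 1) choose m"
proof -
  have fin: "finite A" if "A \<subseteq> U" for A
    using that assms finite_subset by blast
  have "card {A. A \<subseteq> U \<and> card A = Suc m \<and> u \<in> A} = card {A. A \<subseteq> U - {u} \<and> card A = m}"
  proof (rule bij_betw_same_card, rule bij_betw_byWitness[where f' = "insert u"])
    show "(\<lambda>A. A - {u}) ` {A. A \<subseteq> U \<and> card A = Suc m \<and> u \<in> A} \<subseteq> {A. A \<subseteq> U - {u} \<and> card A = m}"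
      using fin by auto
    show "insert u ` {A. A \<subseteq> U - {u} \<and> card A = m} \<subseteq> {A. A \<subseteq> U \<and> card A = Suc m \<and> u \<in> A}"
      using assms fin by (auto simp: subset_Diff_insert card_insert_if)
  qed auto
  then show ?thesis
    using assms by (simp add: n_subsets)
qed

text \<open>
  Fixing a common element \<open>u\<close> excludes disjoint pairs, so that among the sets of the slice
  an intersection of size divisible by \<open>q\<close> has size exactly \<open>q\<close> or \<open>2 q\<close>.
\<close>

lemma card_no_half_distance_le:
  fixes q :: nat
  assumes q: "q = 2 ^ k" and U: "finite U" "card U = 4 * q" and F: "F \<subseteq> Pow U"
    and no: "\<And>A B. A \<in> F \<Longrightarrow> B \<in> F \<Longrightarrow> card (sym_diff A B) \<noteq> 2 * q"
  shows "((4 * q - 1) choose (2 * q - 1)) * card F \<le> (\<Sum>i<q. 4 * q choose i) * 2 ^ (4 * q)"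
proof -
  have q0: "q > 0"
    using q by simp
  then obtain u where u: "u \<in> U"
    using U by (metis card.empty equals0I mult_eq_0_iff not_gr_zero zero_neq_numeral)
  define D where "D = {A. A \<subseteq> U \<and> card A = 2 * q \<and> u \<in> A}"
  have finD: "finite D"
    using U by (simp add: D_def)
  have cardD: "card D = (4 * q - 1) choose (2 * q - 1)"
    using card_subsets_containing[OF U(1) u, of "2 * q - 1"] q0 U by (simp add: D_def)
  obtain g where g: "g \<subseteq> U" "card D * card F \<le> card {T \<in> D. sym_diff g T \<in> F} * 2 ^ card U"
    using exists_dense_translate[OF U(1) finD F, of "\<lambda>T. T"] by (auto simp: D_def)
  let ?E = "{T \<in> D. sym_diff g T \<in> F}"
  have "card ?E \<le> (\<Sum>i<2 ^ k. card U choose i)"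
  proof (rule Frankl_Wilson_two_power[OF U(1)])
    fix A B assume AB: "A \<in> ?E" "B \<in> ?E" "A \<noteq> B"
    then have fin: "finite A" "finite B"
      using U by (auto simp: D_def intro: finite_subset)
    have "sym_diff (sym_diff g A) (sym_diff g B) = sym_diff A B"
      by blast
    then have "card (sym_diff A B) \<noteq> 2 * q"
      using no[of "sym_diff g A" "sym_diff g B"] AB by simp
    \<comment> \<open>Both sets have \<open>2 * q\<close> elements, so their distance is
      \<open>4 * q - 2 * card (A \<inter> B)\<close>.\<close>
    then have nq: "card (A \<inter> B) \<noteq> q"
      using card_sym_diff[OF fin] AB by (auto simp: D_def)
    have "u \<in> A \<inter> B"
      using AB by (auto simp: D_def)
    then have pos: "card (A \<inter> B) > 0"
      using fin by (auto simp: card_gt_0_iff)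
    have "card A = card B"
      using AB by (simp add: D_def)
    then have "\<not> A \<subseteq> B"
      using AB(3) fin card_subset_eq by blast
    then have "A \<inter> B \<subset> A"
      by blast
    then have "card (A \<inter> B) < 2 * q"
      using psubset_card_mono[OF fin(1)] AB by (auto simp: D_def)
    then show "\<not> 2 ^ k dvd card (A \<inter> B)"
      using nq pos unfolding q[symmetric] by (auto simp: dvd_def)
  qed (auto simp: D_def q)
  then show ?thesis
    using order_trans[OF g(2) mult_le_mono1] by (simp only: U cardD q[symmetric])
qed

section \<open>Numerical estimates\<close>

text \<open>Weighting by \<open>(1 / 2) ^ i \<ge> (1 / 2) ^ q\<close> and completing the binomial
  sum gives \<open>2 ^ q * (3 / 2) ^ (4 * q)\<close>.\<close>

lemma sum_binomial_le:
  "real (\<Sum>i<q. 4 * q choose i) \<le> (81 / 8) ^ q"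
proof -
  have "real (\<Sum>i<q. 4 * q choose i) * (1 / 2) ^ q = (\<Sum>i<q. real (4 * q choose i) * (1 / 2) ^ q)"
    by (simp add: sum_distrib_right)
  also have "\<dots> \<le> (\<Sum>i<q. real (4 * q choose i) * (1 / 2) ^ i)"
    by (intro sum_mono mult_left_mono power_decreasing) auto
  also have "\<dots> \<le> (\<Sum>i\<le>4 * q. real (4 * q choose i) * (1 / 2) ^ i)"
    by (intro sum_mono2) auto
  also have "\<dots> = (1 / 2 + 1 :: real) ^ (4 * q)"
    unfolding binomial_ring by (simp add: power_one)
  also have "\<dots> = (81 / 16) ^ q"
    by (simp add: power_mult power4_eq_xxxx)
  finally have "real (\<Sum>i<q. 4 * q choose i) \<le> (81 / 16) ^ q * 2 ^ q"
    by (simp add: field_simps)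
  then show ?thesis
    by (simp add: power_mult_distrib[symmetric])
qed

text \<open>The coefficient is half of the central one, \<open>4 * q choose (2 * q)\<close>.\<close>

lemma binomial_slice_ge:
  assumes "q > 0"
  shows "16 ^ q \<le> 8 * real q * real ((4 * q - 1) choose (2 * q - 1))"
proof -
  have "2 * q * (4 * q choose (2 * q)) = 4 * q * ((4 * q - 1) choose (2 * q - 1))"
    using times_binomial_minus1_eq[of "2 * q" "4 * q"] assms by simp
  then have "(4 * q choose (2 * q)) = 2 * ((4 * q - 1) choose (2 * q - 1))"
    using assms by simp
  moreover have "4 ^ (2 * q) / (2 * real (2 * q)) \<le> real (2 * (2 * q) choose (2 * q))"
    using assms by (intro central_binomial_lower_bound) simp
  moreover have "(4 :: real) ^ (2 * q) = 16 ^ q"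
    by (simp add: power_mult)
  ultimately show ?thesis
    using assms by (simp add: field_simps)
qed

lemma eventually_card_no_half_distance:
  "\<exists>K. \<forall>k\<ge>K. \<forall>U (F :: 'a set set). finite U \<longrightarrow> card U = 4 * 2 ^ k \<longrightarrow> F \<subseteq> Pow U \<longrightarrow>
    (\<forall>A\<in>F. \<forall>B\<in>F. card (sym_diff A B) \<noteq> 2 * 2 ^ k) \<longrightarrow> 2 * real (card F) < 12 ^ 2 ^ k"
proof -
  \<comment> \<open>Here \<open>27 / 32\<close> is the ratio of \<open>81 / 8\<close> to the target
    base 12; the gap absorbs the factor \<open>16 * q\<close>.\<close>
  have "(\<lambda>n. real n * (27 / 32) ^ n) \<longlonglongrightarrow> 0"
    by (intro powser_times_n_limit_0) simp
  then have "\<forall>\<^sub>F n in sequentially. real n * (27 / 32) ^ n < 1 / 16"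
    by (intro order_tendstoD) auto
  then obtain K where K: "\<And>n. n \<ge> K \<Longrightarrow> real n * (27 / 32) ^ n < 1 / 16"
    by (auto simp: eventually_sequentially)
  show ?thesis
  proof (intro exI[of _ K] allI impI)
    fix k and U :: "'a set" and F
    assume k: "K \<le> k" and U: "finite U" "card U = 4 * 2 ^ k" "F \<subseteq> Pow U"
      and no: "\<forall>A\<in>F. \<forall>B\<in>F. card (sym_diff A B) \<noteq> 2 * 2 ^ k"
    define q :: nat where "q = 2 ^ k"
    have q0: "q > 0"
      by (simp add: q_def)
    have "k < q"
      by (simp add: q_def)
    then have Kq: "real q * (27 / 32) ^ q < 1 / 16"
      using K k by simp
    let ?C = "(4 * q - 1) choose (2 * q - 1)"
    have C0: "real ?C > 0"
      using q0 by simp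
    have "?C * card F \<le> (\<Sum>i<q. 4 * q choose i) * 2 ^ (4 * q)"
      using card_no_half_distance_le[OF q_def U(1) _ U(3)] U(2) no by (simp add: q_def)
    then have "real ?C * real (card F) \<le> real (\<Sum>i<q. 4 * q choose i) * 2 ^ (4 * q)"
      by (metis of_nat_le_iff of_nat_mult of_nat_numeral of_nat_power)
    also have "\<dots> \<le> (81 / 8) ^ q * 16 ^ q"
      using sum_binomial_le[of q] by (simp add: power_mult)
    also have "\<dots> \<le> (81 / 8) ^ q * (8 * real q * real ?C)"
      using binomial_slice_ge[OF q0] by (intro mult_left_mono) auto
    finally have "real ?C * real (card F) \<le> real ?C * (8 * real q * (81 / 8) ^ q)"
      by (simp add: mult_ac)
    then have "2 * real (card F) \<le> 16 * real q * (81 / 8) ^ q"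
      using C0 by simp
    also have "(81 / 8 :: real) ^ q = (27 / 32) ^ q * 12 ^ q"
      by (simp add: power_mult_distrib[symmetric])
    also have "16 * real q * ((27 / 32) ^ q * 12 ^ q) < 12 ^ q"
      using Kq by (simp add: field_simps)
    finally show "2 * real (card F) < 12 ^ 2 ^ k"
      by (simp add: q_def)
  qed
qed

section \<open>Cliques in dense families\<close>

lemma sym_diff_vimage:
  "sym_diff (\<pi> -` T \<inter> U) (\<pi> -` T' \<inter> U) = \<pi> -` sym_diff T T' \<inter> U"
  by blast

lemma sym_diff_cancel_left:
  "sym_diff (sym_diff g A) (sym_diff g B) = sym_diff A B"
  by blast

section \<open>Blocks and matchings\<close>

text \<open>Numbering \<open>U\<close> and dividing by \<open>b\<close> cuts it into
  \<open>m\<close> blocks; \<open>\<pi>\<close> gives the index of the block, so preimages are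
  unions of blocks.\<close>

lemma exists_equal_blocks:
  assumes "finite U" "card U = b * m"
  obtains \<pi> :: "'a \<Rightarrow> nat" where "\<And>T. T \<subseteq> {..<m} \<Longrightarrow> card (\<pi> -` T \<inter> U) = b * card T"
proof (cases "b = 0")
  case True
  with assms show ?thesis
    by (intro that[of "\<lambda>_. 0"]) simp
next
  case False
  obtain f where f: "bij_betw f U {..<b * m}"
    using assms ex_bij_betw_finite_nat[OF assms(1)] by (auto simp: atLeast0LessThan)
  show ?thesis
  proof (rule that)
    fix T assume T: "T \<subseteq> {..<m}"
    then have fin: "finite T"
      using finite_subset by blast
    have "bij_betw f ((\<lambda>x. f x div b) -` T \<inter> U) (\<Union>j\<in>T. {j * b..<j * b + b})"
    proof (rule bij_betw_subset[OF f])
      have eq: "i div b \<in> T \<longleftrightarrow> i \<in> (\<Union>j\<in>T. {j * b..<j * b + b})" for i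
      proof -
        have block: "i \<in> {j * b..<j * b + b} \<longleftrightarrow> i div b = j" for j
          using False dividend_less_times_div[of b i] by (auto simp: div_nat_eqI mult.commute)
        show ?thesis
          unfolding UN_iff block by blast
      qed
      have "(\<Union>j\<in>T. {j * b..<j * b + b}) \<subseteq> {..<b * m}"
      proof
        fix i assume "i \<in> (\<Union>j\<in>T. {j * b..<j * b + b})"
        then have "i div b < m"
          using T eq[of i] by auto
        then show "i \<in> {..<b * m}"
          using False by (simp add: div_less_iff_less_mult mult.commute)
      qed
      then have sub: "(\<Union>j\<in>T. {j * b..<j * b + b}) \<subseteq> f ` U"
        using f by (simp add: bij_betw_def)
      have "f ` ((\<lambda>x. f x div b) -` T \<inter> U) = {i. i div b \<in> T} \<inter> f ` U"
        by blast
      also have "{i. i div b \<in> T} = (\<Union>j\<in>T. {j * b..<j * b + b})"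
        by (simp only: eq Collect_mem_eq)
      finally show "f ` ((\<lambda>x. f x div b) -` T \<inter> U) = (\<Union>j\<in>T. {j * b..<j * b + b})"
        using sub by (simp only: Int_absorb2)
    qed auto
    then have "card ((\<lambda>x. f x div b) -` T \<inter> U) = card (\<Union>j\<in>T. {j * b..<j * b + b})"
      by (rule bij_betw_same_card)
    also have "\<dots> = (\<Sum>j\<in>T. card {j * b..<j * b + b})"
    proof (intro card_UN_disjoint ballI impI fin)
      fix i j :: nat assume "i \<noteq> j"
      show "{i * b..<i * b + b} \<inter> {j * b..<j * b + b} = {}"
      proof (rule ccontr)
        assume "\<not> ?thesis"
        then obtain x where "x \<in> {i * b..<i * b + b}" "x \<in> {j * b..<j * b + b}"
          by blast
        then have "x div b = i" "x div b = j"
          by (auto intro!: div_nat_eqI simp: mult.commute)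
        with \<open>i \<noteq> j\<close> show False
          by simp
      qed
    qed simp
    finally show "card ((\<lambda>x. f x div b) -` T \<inter> U) = b * card T"
      by simp
  qed
qed

text \<open>\<open>\<pi>\<close> numbers \<open>s\<close> and its complement separately, so each
  fibre is a pair with one element on each side. A union of pairs differs from \<open>s\<close> by
  one element per pair: the outer one if the pair is chosen, the inner one otherwise.\<close>

lemma exists_matching_of_halves:
  assumes "finite U" "s \<subseteq> U" "card s = m" "card U = 2 * m"
  obtains \<pi> :: "'a \<Rightarrow> nat" where
    "\<And>T. T \<subseteq> {..<m} \<Longrightarrow> card (\<pi> -` T \<inter> U) = 2 * card T"
    "\<And>T. T \<subseteq> {..<m} \<Longrightarrow> card (sym_diff (\<pi> -` T \<inter> U) s) = m"
proof -
  have fin: "finite s" "finite (U - s)"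
    using assms finite_subset by auto
  then have card_compl: "card (U - s) = m"
    using assms by (simp add: card_Diff_subset)
  obtain f1 where f1: "bij_betw f1 s {..<m}"
    using ex_bij_betw_finite_nat[OF fin(1)] assms(3) by (auto simp: atLeast0LessThan)
  obtain f2 where f2: "bij_betw f2 (U - s) {..<m}"
    using ex_bij_betw_finite_nat[OF fin(2)] card_compl by (auto simp: atLeast0LessThan)
  have card_vimage: "card (f -` T \<inter> X) = card T" if "bij_betw f X {..<m}" "T \<subseteq> {..<m}"
    for f :: "'a \<Rightarrow> nat" and X T
  proof -
    have "f ` (f -` T \<inter> X) = T \<inter> f ` X"
      by blast
    also have "\<dots> = T"
      using that by (auto simp: bij_betw_def)
    finally have "f ` (f -` T \<inter> X) = T" .
    then have "bij_betw f (f -` T \<inter> X) T"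
      by (intro bij_betw_subset[OF that(1)] Int_lower2)
    then show ?thesis
      by (rule bij_betw_same_card)
  qed
  let ?\<pi> = "\<lambda>x. if x \<in> s then f1 x else f2 x"
  show ?thesis
  proof (rule that)
    fix T assume T: "T \<subseteq> {..<m}"
    have "?\<pi> -` T \<inter> U = (f1 -` T \<inter> s) \<union> (f2 -` T \<inter> (U - s))"
      using assms by (auto split: if_splits)
    also have "card \<dots> = card (f1 -` T \<inter> s) + card (f2 -` T \<inter> (U - s))"
      using fin by (intro card_Un_disjoint) auto
    finally show "card (?\<pi> -` T \<inter> U) = 2 * card T"
      using card_vimage[OF f1 T] card_vimage[OF f2 T] by simp
    have "sym_diff (?\<pi> -` T \<inter> U) s = (f1 -` ({..<m} - T) \<inter> s) \<union> (f2 -` T \<inter> (U - s))"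
      using assms f1 by (auto simp: bij_betw_def split: if_splits)
    also have "card \<dots> = card (f1 -` ({..<m} - T) \<inter> s) + card (f2 -` T \<inter> (U - s))"
      using fin by (intro card_Un_disjoint) auto
    also have "\<dots> = card ({..<m} - T) + card T"
      using card_vimage[OF f1, of "{..<m} - T"] card_vimage[OF f2 T] by simp
    also have "\<dots> = m"
      using T card_mono[OF _ T] finite_subset[OF T] by (simp add: card_Diff_subset)
    finally show "card (sym_diff (?\<pi> -` T \<inter> U) s) = m" .
  qed
qed

abbreviation half_distant :: "nat \<Rightarrow> 'a set set \<Rightarrow> bool" where
  "half_distant m \<equiv> pairwise (\<lambda>A B. card (sym_diff A B) = m)"

text \<open>A clique in the trace of \<open>X\<close> on a coset of unions of matched pairs doubles
  its distances when lifted. Shifting one lifted member by \<open>s\<close> gives a further member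
  of \<open>F\<close> at distance \<open>2 * m\<close> from all of them.\<close>

lemma extend_half_distant:
  assumes U: "finite U" "card U = 4 * m" and s: "s \<subseteq> U" "card s = 2 * m" and "m > 0" "r > 0"
    and F: "F \<subseteq> Pow U" and X: "X = {A \<in> F. sym_diff A s \<in> F}"
    and dense: "x * 2 ^ (4 * m) \<le> real (card X)"
    and clique: "\<And>F'. F' \<subseteq> Pow {..<2 * m} \<Longrightarrow> x * 2 ^ (2 * m) \<le> real (card F') \<Longrightarrow>
      \<exists>Q\<subseteq>F'. card Q = r \<and> half_distant m Q"
  shows "\<exists>Q\<subseteq>F. card Q = Suc r \<and> half_distant (2 * m) Q"
proof -
  obtain \<pi> where \<pi>: "\<And>T. T \<subseteq> {..<2 * m} \<Longrightarrow> card (\<pi> -` T \<inter> U) = 2 * card T"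
    "\<And>T. T \<subseteq> {..<2 * m} \<Longrightarrow> card (sym_diff (\<pi> -` T \<inter> U) s) = 2 * m"
    using exists_matching_of_halves[OF U(1) s] U(2) by (metis mult.assoc mult_2 numeral_Bit0)
  define w where "w T = \<pi> -` T \<inter> U" for T
  have XU: "X \<subseteq> Pow U"
    using F X by auto
  \<comment> \<open>Averaging selects a coset on which \<open>X\<close> retains its relative density
    \<open>x\<close>.\<close>
  obtain g where g: "card (Pow {..<2 * m}) * card X
      \<le> card {T \<in> Pow {..<2 * m}. sym_diff g (w T) \<in> X} * 2 ^ card U"
    by (rule exists_dense_translate[OF U(1) _ XU, of "Pow {..<2 * m}" w]) (auto simp: w_def)
  define F' where "F' = {T \<in> Pow {..<2 * m}. sym_diff g (w T) \<in> X}"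
  have "x * 2 ^ (2 * m) * 2 ^ (4 * m) \<le> 2 ^ (2 * m) * real (card X)"
    using mult_left_mono[OF dense, of "2 ^ (2 * m)"] by (simp add: mult.commute mult.left_commute)
  also have "\<dots> \<le> real (card F') * 2 ^ (4 * m)"
    using of_nat_mono[OF g, where 'a = real] U by (simp add: card_Pow F'_def)
  finally have "x * 2 ^ (2 * m) \<le> real (card F')"
    by simp
  moreover have F'_sub: "F' \<subseteq> Pow {..<2 * m}"
    by (auto simp: F'_def)
  ultimately obtain Q where Q: "Q \<subseteq> F'" "card Q = r" "half_distant m Q"
    using clique by blast
  then have finQ: "finite Q"
    using \<open>r > 0\<close> card.infinite by fastforce
  obtain T0 where T0: "T0 \<in> Q"
    using Q \<open>r > 0\<close> by fastforce
  define h where "h T = sym_diff g (w T)" for T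
  define z where "z = sym_diff (h T0) s"
  have Tsub: "T \<subseteq> {..<2 * m}" if "T \<in> Q" for T
    using that Q F'_sub by auto
  have hX: "h T \<in> X" if "T \<in> Q" for T
    using that Q by (auto simp: F'_def h_def)
  have dist_h: "card (sym_diff (h A) (h B)) = 2 * m" if "A \<in> Q" "B \<in> Q" "A \<noteq> B" for A B
  proof -
    have "sym_diff A B \<subseteq> {..<2 * m}"
      using Tsub that by blast
    moreover have "card (sym_diff A B) = m"
      using Q(3) that by (auto simp: pairwise_def)
    ultimately have "card (\<pi> -` sym_diff A B \<inter> U) = 2 * m"
      by (simp only: \<pi>(1))
    then show ?thesis
      unfolding h_def sym_diff_cancel_left w_def sym_diff_vimage .
  qed
  have dist_z: "card (sym_diff (h A) z) = 2 * m" if "A \<in> Q" for A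
  proof -
    \<comment> \<open>The translation \<open>g\<close> cancels, leaving a union of pairs compared
      with \<open>s\<close>; this also covers \<open>A = T0\<close>.\<close>
    have "sym_diff (h A) z = sym_diff (sym_diff (w A) (w T0)) s"
      unfolding z_def h_def by blast
    then have "sym_diff (h A) z = sym_diff (\<pi> -` sym_diff A T0 \<inter> U) s"
      unfolding w_def sym_diff_vimage .
    moreover have "sym_diff A T0 \<subseteq> {..<2 * m}"
      using Tsub that T0 by blast
    ultimately show ?thesis
      by (simp only: \<pi>(2))
  qed
  have "inj_on h Q"
  proof (rule inj_onI, rule ccontr)
    fix A B assume "A \<in> Q" "B \<in> Q" "h A = h B" "A \<noteq> B"
    then show False
      using dist_h[of A B] \<open>m > 0\<close> by simp
  qed
  then have "card (h ` Q) = r"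
    using Q by (simp add: card_image)
  moreover have "z \<notin> h ` Q"
  proof
    assume "z \<in> h ` Q"
    then obtain A where "A \<in> Q" "z = h A"
      by auto
    then show False
      using dist_z[of A] \<open>m > 0\<close> by simp
  qed
  ultimately have "card (insert z (h ` Q)) = Suc r"
    using finQ by simp
  moreover have "insert z (h ` Q) \<subseteq> F"
    using hX T0 X by (auto simp: z_def)
  moreover have "half_distant (2 * m) (insert z (h ` Q))"
    unfolding pairwise_insert
    using dist_z dist_h by (auto simp: pairwise_def Un_commute)
  ultimately show ?thesis
    by blast
qed

text \<open>
  Apart from fewer than half of its members, each \<open>A \<in> F\<close> has a neighbour \<open>sym_diff A s\<close> in \<open>F\<close>
  where \<open>s\<close> is a union of blocks. There are so few of those \<open>s\<close> that one of them serves many \<open>A\<close>.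
\<close>

lemma exists_popular_shift:
  fixes q :: nat
  assumes small: "\<And>F :: nat set set. F \<subseteq> Pow {..<4 * q} \<Longrightarrow>
      (\<And>A B. A \<in> F \<Longrightarrow> B \<in> F \<Longrightarrow> card (sym_diff A B) \<noteq> 2 * q) \<Longrightarrow> 2 * real (card F) < 12 ^ q"
    and U: "finite U" "card U = b * (4 * q)" and q: "q > 0" and F: "F \<subseteq> Pow U"
    and dense: "(3 / 4) ^ q * 2 ^ card U \<le> real (card F)"
  obtains s where "s \<subseteq> U" "card s = b * (2 * q)"
    "2 ^ card U / 256 ^ q \<le> real (card {A \<in> F. sym_diff A s \<in> F})"
proof -
  obtain \<pi> where \<pi>: "\<And>T. T \<subseteq> {..<4 * q} \<Longrightarrow> card (\<pi> -` T \<inter> U) = b * card T"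
    using exists_equal_blocks[OF U] by blast
  define w where "w T = \<pi> -` T \<inter> U" for T
  define S where "S = w ` {T. T \<subseteq> {..<4 * q} \<and> card T = 2 * q}"
  define X where "X s = {A \<in> F. sym_diff A s \<in> F}" for s
  \<comment> \<open>\<open>F0\<close> collects the members that no shift in \<open>S\<close> keeps
    inside \<open>F\<close>.\<close>
  define F0 where "F0 = F - (\<Union>s\<in>S. X s)"
  have finF: "finite F"
    using F U finite_subset by (metis finite_Pow_iff)
  have finS: "finite S"
    unfolding S_def by (intro finite_imageI) simp
  have finX: "finite (X s)" for s
    using finF by (simp add: X_def)
  \<comment> \<open>The number of shifts is bounded independently of the block size
    \<open>b\<close>.\<close>
  have "card S \<le> card {T. T \<subseteq> {..<4 * q} \<and> card T = 2 * q}"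
    unfolding S_def by (intro card_image_le) simp
  also have "\<dots> \<le> card (Pow {..<4 * q})"
    by (intro card_mono) auto
  finally have "card S \<le> 16 ^ q"
    by (simp add: card_Pow power_mult)
  then have cardS: "real (card S) \<le> 16 ^ q"
    by (metis of_nat_le_iff of_nat_numeral of_nat_power)
  have F0U: "F0 \<subseteq> Pow U"
    using F by (auto simp: F0_def)
  obtain g where g: "card (Pow {..<4 * q}) * card F0
      \<le> card {T \<in> Pow {..<4 * q}. sym_diff g (w T) \<in> F0} * 2 ^ card U"
    by (rule exists_dense_translate[OF U(1) _ F0U, of "Pow {..<4 * q}" w]) (auto simp: w_def)
  let ?E = "{T \<in> Pow {..<4 * q}. sym_diff g (w T) \<in> F0}"
  \<comment> \<open>Two members of \<open>?E\<close> at distance \<open>2 * q\<close> would give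
    members of \<open>F0\<close> that differ by a shift in \<open>S\<close>.\<close>
  have E: "2 * real (card ?E) < 12 ^ q"
  proof (rule small)
    fix A B assume AB: "A \<in> ?E" "B \<in> ?E"
    show "card (sym_diff A B) \<noteq> 2 * q"
    proof
      assume "card (sym_diff A B) = 2 * q"
      moreover have "sym_diff A B \<subseteq> {..<4 * q}"
        using AB by blast
      ultimately have S: "w (sym_diff A B) \<in> S"
        by (auto simp: S_def)
      have "sym_diff (sym_diff g (w A)) (w (sym_diff A B)) = sym_diff g (w B)"
        unfolding w_def by blast
      then have "sym_diff g (w A) \<in> X (w (sym_diff A B))"
        using AB by (simp add: X_def F0_def)
      with S AB show False
        by (auto simp: F0_def)
    qed
  qed auto
  have "16 ^ q * real (card F0) \<le> real (card ?E) * 2 ^ card U"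
    using of_nat_mono[OF g, where 'a = real] by (simp add: card_Pow power_mult)
  also have "\<dots> < 12 ^ q / 2 * 2 ^ card U"
    using E by (intro mult_strict_right_mono) auto
  also have "(12 :: real) ^ q = 16 ^ q * (3 / 4) ^ q"
    by (simp add: power_mult_distrib[symmetric])
  finally have F0: "real (card F0) < (3 / 4) ^ q / 2 * 2 ^ card U"
    by simp
  \<comment> \<open>Of \<open>256 ^ q = 16 ^ q * 16 ^ q\<close>, one factor pays for the number of
    shifts; the other makes their total at most half of the assumed size of
    \<open>F\<close>.\<close>
  have "\<exists>s\<in>S. 2 ^ card U / 256 ^ q \<le> real (card (X s))"
  proof (rule ccontr)
    assume "\<not> ?thesis"
    then have less: "real (card (X s)) \<le> 2 ^ card U / 256 ^ q" if "s \<in> S" for s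
      using that by force
    have "F \<subseteq> F0 \<union> (\<Union>s\<in>S. X s)"
      by (auto simp: F0_def)
    then have "card F \<le> card (F0 \<union> (\<Union>s\<in>S. X s))"
      using finF finS finX by (intro card_mono) (auto simp: F0_def)
    also have "\<dots> \<le> card F0 + card (\<Union>s\<in>S. X s)"
      by (rule card_Un_le)
    also have "card (\<Union>s\<in>S. X s) \<le> (\<Sum>s\<in>S. card (X s))"
      by (rule card_UN_le[OF finS])
    finally have "real (card F) \<le> real (card F0) + (\<Sum>s\<in>S. real (card (X s)))"
      by (simp flip: of_nat_sum of_nat_add)
    also have "(\<Sum>s\<in>S. real (card (X s))) \<le> real (card S) * (2 ^ card U / 256 ^ q)"
      using sum_mono[of S "\<lambda>s. real (card (X s))" "\<lambda>_. 2 ^ card U / 256 ^ q"] less by simp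
    also have "\<dots> \<le> 16 ^ q * (2 ^ card U / 256 ^ q)"
      using cardS by (intro mult_right_mono) auto
    also have "(256 :: real) ^ q = 16 ^ q * 16 ^ q"
      by (simp add: power_mult_distrib[symmetric])
    also have "16 ^ q * (2 ^ card U / (16 ^ q * 16 ^ q)) = (1 / 16 :: real) ^ q * 2 ^ card U"
      by (simp add: power_divide)
    also have "(1 / 16 :: real) ^ q = (3 / 4) ^ q * (1 / 12) ^ q"
      by (simp add: power_mult_distrib[symmetric])
    also have "(1 / 12 :: real) ^ q \<le> 1 / 2"
      using power_decreasing[of 1 q "1 / 12 :: real"] q by simp
    finally have "real (card F) \<le> real (card F0) + (3 / 4) ^ q * (1 / 2) * 2 ^ card U"
      by simp
    with F0 dense show False
      by simp
  qed
  then obtain s where "s \<in> S" and X: "2 ^ card U / 256 ^ q \<le> real (card (X s))"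
    by blast
  then obtain T where "T \<subseteq> {..<4 * q}" "card T = 2 * q" "s = w T"
    by (auto simp: S_def)
  then have "s \<subseteq> U" "card s = b * (2 * q)"
    using \<pi>[of T] by (auto simp: w_def)
  with X that show ?thesis
    unfolding X_def by blast
qed

theorem dense_family_half_distant:
  assumes "r \<ge> 1"
  shows "\<exists>c::real. 0 < c \<and> c < 1 \<and> (\<exists>a0. \<forall>a\<ge>a0. \<forall>F\<subseteq>Pow {..<2 ^ a :: nat}.
    (2 * c) ^ 2 ^ a \<le> real (card F) \<longrightarrow> (\<exists>Q\<subseteq>F. card Q = r \<and> half_distant (2 ^ (a - 1)) Q))"
  using assms
proof (induction r rule: dec_induct)
  case base
  have "\<exists>Q\<subseteq>F. card Q = 1 \<and> half_distant (2 ^ (a - 1)) Q"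
    if "(2 * (1 / 2)) ^ 2 ^ a \<le> real (card F)" for F :: "nat set set" and a :: nat
  proof -
    have "F \<noteq> {}"
      using that by auto
    then obtain A where "A \<in> F"
      by blast
    then show ?thesis
      by (intro exI[of _ "{A}"]) auto
  qed
  then show ?case
    by (intro exI[of _ "1 / 2"]) auto
next
  case (step r)
  from step.IH obtain c :: real and a0 where c: "0 < c" "c < 1"
    and IH: "\<forall>a\<ge>a0. \<forall>F\<subseteq>Pow {..<2 ^ a :: nat}. (2 * c) ^ 2 ^ a \<le> real (card F) \<longrightarrow>
      (\<exists>Q\<subseteq>F. card Q = r \<and> half_distant (2 ^ (a - 1)) Q)"
    by (elim exE conjE)
  from eventually_card_no_half_distance[where 'a = nat]
  obtain K where K: "\<forall>k\<ge>K. \<forall>U (F :: nat set set). finite U \<longrightarrow> card U = 4 * 2 ^ k \<longrightarrow> F \<subseteq> Pow U \<longrightarrow>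
    (\<forall>A\<in>F. \<forall>B\<in>F. card (sym_diff A B) \<noteq> 2 * 2 ^ k) \<longrightarrow> 2 * real (card F) < 12 ^ 2 ^ k"
    by (elim exE)
  \<comment> \<open>The block size \<open>b = 2 ^ t\<close> is a power of two, so the number of
    blocks is one as well. With \<open>c ^ b \<le> 1 / 16\<close>, the loss \<open>256 ^ q\<close>
    in \<open>exists_popular_shift\<close> stays within the density that the induction hypothesis
    tolerates.\<close>
  obtain t where t: "c ^ t < 1 / 16"
    using real_arch_pow_inv[of "1 / 16" c] c by auto
  define b :: nat where "b = 2 ^ t"
  have "c ^ b \<le> c ^ t"
    using c by (intro power_decreasing) (auto simp: b_def intro: less_imp_le)
  then have cb: "c ^ b \<le> 1 / 16"
    using t by simp
  have b: "real b \<ge> 1"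
    by (simp add: b_def)
  \<comment> \<open>Chosen so that Bernoulli's inequality gives
    \<open>c' ^ (4 * b) \<ge> 1 - 1 / 4\<close>, the density per \<open>q\<close> needed for a
    popular shift.\<close>
  define c' where "c' = 1 - 1 / (16 * real b)"
  have c': "0 < c'" "c' < 1"
    using b by (auto simp: c'_def field_simps)
  have "1 + real (4 * b) * (- (1 / (16 * real b))) \<le> (1 + - (1 / (16 * real b))) ^ (4 * b)"
    using b by (intro Bernoulli_inequality) (simp add: field_simps)
  then have c'_pow: "3 / 4 \<le> c' ^ (4 * b)"
    using b by (simp add: c'_def)
  have "\<exists>Q\<subseteq>F. card Q = Suc r \<and> half_distant (2 ^ (a - 1)) Q"
    \<comment> \<open>The bound \<open>a0 + 1\<close> serves the induction hypothesis at
      \<open>a - 1\<close>; the other one ensures \<open>a - t - 2 \<ge> K\<close>.\<close>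
    if a: "a \<ge> max (a0 + 1) (K + t + 2)" and F: "F \<subseteq> Pow {..<2 ^ a :: nat}"
      and dense: "(2 * c') ^ 2 ^ a \<le> real (card F)" for a F
  proof -
    define k where "k = a - t - 2"
    have k: "k \<ge> K" "a = k + t + 2"
      using a by (auto simp: k_def)
    define q :: nat where "q = 2 ^ k"
    define m where "m = b * q"
    have q0: "q > 0" and m0: "m > 0"
      by (auto simp: q_def m_def b_def)
    have pow_a: "2 ^ a = 4 * m" "2 ^ (a - 1) = 2 * m" "2 ^ (a - 1 - 1) = m"
      by (simp_all add: k(2) m_def b_def q_def power_add)
    have "(3 / 4) ^ q * 2 ^ (4 * m) \<le> (c' ^ (4 * b)) ^ q * 2 ^ (4 * m)"
      using c'_pow by (intro mult_right_mono power_mono) auto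
    also have "\<dots> = (2 * c') ^ 2 ^ a"
      by (simp add: pow_a m_def power_mult_distrib power_mult[symmetric] mult_ac)
    also have "\<dots> \<le> real (card F)"
      by (rule dense)
    finally have dense': "(3 / 4) ^ q * 2 ^ card {..<2 ^ a :: nat} \<le> real (card F)"
      by (simp add: pow_a)
    have small: "2 * real (card F) < 12 ^ q" if "F \<subseteq> Pow {..<4 * q}"
      "\<And>A B. A \<in> F \<Longrightarrow> B \<in> F \<Longrightarrow> card (sym_diff A B) \<noteq> 2 * q" for F :: "nat set set"
      using K[rule_format, OF k(1), of "{..<4 * q}" F] that by (simp add: q_def)
    obtain s where s: "s \<subseteq> {..<2 ^ a}" "card s = b * (2 * q)"
      "2 ^ card {..<2 ^ a :: nat} / 256 ^ q \<le> real (card {A \<in> F. sym_diff A s \<in> F})"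
      by (rule exists_popular_shift[OF small _ _ q0 F dense', of b]) (auto simp: pow_a m_def)
    have "c ^ (2 * m) = (c ^ b) ^ (2 * q)"
      by (simp add: m_def power_mult[symmetric] mult_ac)
    also have "\<dots> \<le> (1 / 16) ^ (2 * q)"
      using cb c by (intro power_mono) auto
    also have "\<dots> = 1 / 256 ^ q"
      by (simp add: power_mult power_divide)
    finally have "c ^ (2 * m) * 2 ^ (4 * m) \<le> 1 / 256 ^ q * 2 ^ (4 * m)"
      by (intro mult_right_mono) auto
    with s(3) have X: "c ^ (2 * m) * 2 ^ (4 * m) \<le> real (card {A \<in> F. sym_diff A s \<in> F})"
      by (simp add: pow_a)
    have "\<exists>Q\<subseteq>F. card Q = Suc r \<and> half_distant (2 * m) Q"
    proof (rule extend_half_distant[OF _ _ s(1) _ m0 _ F refl X])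
      fix F' assume "F' \<subseteq> Pow {..<2 * m}" "c ^ (2 * m) * 2 ^ (2 * m) \<le> real (card F')"
      then show "\<exists>Q\<subseteq>F'. card Q = r \<and> half_distant m Q"
        using IH[rule_format, of "a - 1" F'] a unfolding pow_a by (simp add: power_mult_distrib mult.commute)
    qed (use step.hyps s(2) in \<open>auto simp: pow_a m_def\<close>)
    then show ?thesis
      unfolding pow_a .
  qed
  then have "\<forall>a\<ge>max (a0 + 1) (K + t + 2). \<forall>F\<subseteq>Pow {..<2 ^ a :: nat}.
      (2 * c') ^ 2 ^ a \<le> real (card F) \<longrightarrow> (\<exists>Q\<subseteq>F. card Q = Suc r \<and> half_distant (2 ^ (a - 1)) Q)"
    by (intro allI impI)
  with c' show ?case
    by (intro exI conjI)
qed

section \<open>Tensor squares of sign vectors\<close>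

definition sign_of :: "nat set \<Rightarrow> nat \<Rightarrow> real" where
  "sign_of A i = (if i \<in> A then 1 else - 1)"

text \<open>The normalised tensor square of the sign vector of \<open>A\<close>, with \<open>(i, j)\<close> stored at \<open>i * n + j\<close>.\<close>

definition tensor_point :: "nat \<Rightarrow> nat set \<Rightarrow> nat \<Rightarrow> real" where
  "tensor_point n A j =
    (if j < n * n then sign_of A (j div n) * sign_of A (j mod n) / (sqrt 2 * real n) else 0)"

lemma sum_sign_of:
  assumes "A \<subseteq> {..<n}" "B \<subseteq> {..<n}"
  shows "(\<Sum>i<n. sign_of A i * sign_of B i) = real n - 2 * real (card (sym_diff A B))"
proof -
  have "(\<Sum>i<n. sign_of A i * sign_of B i) = (\<Sum>i<n. 1 - 2 * of_bool (i \<in> sym_diff A B))"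
    by (intro sum.cong) (auto simp: sign_of_def)
  also have "\<dots> = real n - 2 * (\<Sum>i<n. of_bool (i \<in> sym_diff A B))"
    by (simp only: sum_subtractf sum_distrib_left[symmetric]) simp
  also have "(\<Sum>i<n. of_bool (i \<in> sym_diff A B)) = real (card ({..<n} \<inter> sym_diff A B))"
    by (subst sum_of_bool_eq) (simp_all only: finite_lessThan Collect_mem_eq)
  also have "{..<n} \<inter> sym_diff A B = sym_diff A B"
    using assms by blast
  finally show ?thesis .
qed

text \<open>The inner product of two tensor squares is the square of the inner product, so the
  squared distance is 1 minus the squared normalised inner product of the sign vectors.\<close>

lemma edist_tensor_point:
  assumes "n > 0" "n * n \<le> d" "A \<subseteq> {..<n}" "B \<subseteq> {..<n}"
  shows "edist d (tensor_point n A) (tensor_point n B)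
    = sqrt (1 - (1 - 2 * real (card (sym_diff A B)) / real n)\<^sup>2)"
proof -
  let ?a = "sign_of A" and ?b = "sign_of B"
  let ?h = "\<lambda>j. (?a (j div n) * ?a (j mod n) - ?b (j div n) * ?b (j mod n))\<^sup>2"
  let ?ip = "\<Sum>i<n. ?a i * ?b i"
  have "(\<Sum>j<d. (tensor_point n A j - tensor_point n B j)\<^sup>2)
      = (\<Sum>j<n * n. (tensor_point n A j - tensor_point n B j)\<^sup>2)"
    using assms by (intro sum.mono_neutral_right) (auto simp: tensor_point_def)
  also have "\<dots> = (\<Sum>j<n * n. ?h j / (2 * (real n)\<^sup>2))"
    by (intro sum.cong)
      (auto simp: tensor_point_def diff_divide_distrib[symmetric] power_divide power_mult_distrib)
  also have "\<dots> = (\<Sum>j<n * n. ?h j) / (2 * (real n)\<^sup>2)"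
    by (simp add: sum_divide_distrib)
  also have "(\<Sum>j<n * n. ?h j) = (\<Sum>i<n. \<Sum>j=i * n..<i * n + n. ?h j)"
    by (rule sum.nat_group[symmetric])
  also have "\<dots> = (\<Sum>i<n. \<Sum>j<n. (?a i * ?a j - ?b i * ?b j)\<^sup>2)"
  proof (rule sum.cong[OF refl])
    fix i
    have "(\<Sum>j=i * n..<i * n + n. ?h j) = (\<Sum>j=0..<n. ?h (j + i * n))"
      using sum.shift_bounds_nat_ivl[of ?h 0 "i * n" n] by (simp add: add.commute)
    also have "\<dots> = (\<Sum>j<n. (?a i * ?a j - ?b i * ?b j)\<^sup>2)"
      using assms by (intro sum.cong) auto
    finally show "(\<Sum>j=i * n..<i * n + n. ?h j) = (\<Sum>j<n. (?a i * ?a j - ?b i * ?b j)\<^sup>2)" .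
  qed
  \<comment> \<open>All products of signs are 1 or -1, so each square expands to 2 minus twice a
    product.\<close>
  also have "\<dots> = (\<Sum>i<n. \<Sum>j<n. 2 - 2 * ((?a i * ?b i) * (?a j * ?b j)))"
    by (intro sum.cong) (auto simp: sign_of_def power2_eq_square)
  also have "\<dots> = 2 * (real n)\<^sup>2 - 2 * (\<Sum>i<n. \<Sum>j<n. (?a i * ?b i) * (?a j * ?b j))"
    by (simp only: sum_subtractf sum_distrib_left[symmetric]) (simp add: power2_eq_square)
  also have "(\<Sum>i<n. \<Sum>j<n. (?a i * ?b i) * (?a j * ?b j)) = ?ip\<^sup>2"
    by (simp only: sum_product power2_eq_square)
  also have "(2 * (real n)\<^sup>2 - 2 * ?ip\<^sup>2) / (2 * (real n)\<^sup>2) = 1 - (?ip / real n)\<^sup>2"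
    using assms by (simp add: field_simps)
  also have "?ip / real n = 1 - 2 * real (card (sym_diff A B)) / real n"
    using assms by (simp add: sum_sign_of diff_divide_distrib)
  finally show ?thesis
    by (simp add: edist_def L2_set_def)
qed

lemma edist_tensor_point_half:
  assumes "n > 0" "n * n \<le> d" "A \<subseteq> {..<n}" "B \<subseteq> {..<n}" "2 * card (sym_diff A B) = n"
  shows "edist d (tensor_point n A) (tensor_point n B) = 1"
proof -
  have "2 * real (card (sym_diff A B)) = real n"
    using assms(5) by linarith
  then show ?thesis
    using assms by (simp add: edist_tensor_point)
qed

lemma ediameter_tensor_points:
  assumes "n > 0" "even n" "n * n \<le> d"
  shows "ediameter d (tensor_point n ` Pow {..<n}) = 1"
  unfolding ediameter_def
proof (rule Max_eqI)
  let ?P = "tensor_point n ` Pow {..<n}"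
  have "{edist d x y |x y. x \<in> ?P \<and> y \<in> ?P} = (\<lambda>(x, y). edist d x y) ` (?P \<times> ?P)"
    by auto
  then show "finite {edist d x y |x y. x \<in> ?P \<and> y \<in> ?P}"
    by simp
  show "z \<le> 1" if "z \<in> {edist d x y |x y. x \<in> ?P \<and> y \<in> ?P}" for z
    using that assms by (auto simp: edist_tensor_point)
  have "edist d (tensor_point n {}) (tensor_point n {..<n div 2}) = 1"
    using assms by (intro edist_tensor_point_half) auto
  moreover have "{..<n div 2} \<in> Pow {..<n}" "{} \<in> Pow {..<n}"
    by auto
  ultimately show "1 \<in> {edist d x y |x y. x \<in> ?P \<and> y \<in> ?P}"
    by (smt (verit) image_eqI mem_Collect_eq)
qed

section \<open>From colorings to monochromatic cliques\<close>

lemma exists_large_color_class: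
  fixes f :: "'a \<Rightarrow> nat"
  assumes "f ` V \<subseteq> {..<k}" "real k * x < real (card V)"
  shows "\<exists>i. x \<le> real (card {v \<in> V. f v = i})"
proof (rule ccontr)
  assume "\<not> ?thesis"
  then have small: "real (card {v \<in> V. f v = i}) \<le> x" for i
    by (meson nle_le)
  have "V = (\<Union>i<k. {v \<in> V. f v = i})"
    using assms(1) by auto
  then have "card V \<le> (\<Sum>i<k. card {v \<in> V. f v = i})"
    using card_UN_le[of "{..<k}" "\<lambda>i. {v \<in> V. f v = i}"] by simp
  then have "real (card V) \<le> (\<Sum>i<k. real (card {v \<in> V. f v = i}))"
    by (simp flip: of_nat_sum)
  also have "\<dots> \<le> (\<Sum>i<k. x)"
    by (intro sum_mono small)
  finally show False
    using assms(2) by simp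
qed

theorem theorem1:
  shows "\<forall>r::nat. r \<ge> 2 \<longrightarrow>
    (\<exists>\<epsilon>::real. \<epsilon> > 0 \<and> (\<exists>d0::nat. \<forall>d::nat. d \<ge> d0 \<longrightarrow>
      (\<exists>P :: (nat \<Rightarrow> real) set.
         P \<subseteq> topspace (Euclidean_space d) \<and> finite P \<and> P \<noteq> {} \<and> ediameter d P = 1 \<and>
         (\<forall>(k::nat) (col :: (nat \<Rightarrow> real) \<Rightarrow> nat).
            real k < (1 + \<epsilon>) powr sqrt (real d) \<and> col ` P \<subseteq> {..<k} \<longrightarrow>
            (\<exists>Q. Q \<subseteq> P \<and> card Q = r \<and> (\<exists>c. \<forall>x\<in>Q. col x = c) \<and>
               (\<forall>x\<in>Q. \<forall>y\<in>Q. x \<noteq> y \<longrightarrow> edist d x y = 1))))))"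
proof (intro allI impI)
  fix r :: nat assume "r \<ge> 2"
  then have "r \<ge> 1"
    by simp
  from dense_family_half_distant[OF this] obtain c :: real and a0 where c: "0 < c" "c < 1"
    and clique: "\<forall>a\<ge>a0. \<forall>F\<subseteq>Pow {..<2 ^ a :: nat}. (2 * c) ^ 2 ^ a \<le> real (card F) \<longrightarrow>
      (\<exists>Q\<subseteq>F. card Q = r \<and> half_distant (2 ^ (a - 1)) Q)"
    by (elim exE conjE)
  \<comment> \<open>The square root compensates for \<open>sqrt d < 2 * n\<close>: fewer than
    \<open>(1 / c) ^ n\<close> colors remain, so some class has at least \<open>(2 * c) ^ n\<close>
    of the \<open>2 ^ n\<close> sets.\<close>
  define \<epsilon> where "\<epsilon> = sqrt (1 / c) - 1"
  have \<epsilon>: "\<epsilon> > 0" "(1 + \<epsilon>)\<^sup>2 = 1 / c"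
    using c by (auto simp: \<epsilon>_def)
  have "\<exists>P. P \<subseteq> topspace (Euclidean_space d) \<and> finite P \<and> P \<noteq> {} \<and> ediameter d P = 1 \<and>
      (\<forall>(k::nat) (col :: (nat \<Rightarrow> real) \<Rightarrow> nat).
        real k < (1 + \<epsilon>) powr sqrt (real d) \<and> col ` P \<subseteq> {..<k} \<longrightarrow>
        (\<exists>Q. Q \<subseteq> P \<and> card Q = r \<and> (\<exists>c. \<forall>x\<in>Q. col x = c) \<and>
          (\<forall>x\<in>Q. \<forall>y\<in>Q. x \<noteq> y \<longrightarrow> edist d x y = 1)))" if d: "d \<ge> 4 ^ (a0 + 1)" for d
  proof -
    have "d \<ge> 1"
      using d by (meson le_trans one_le_numeral one_le_power)
    then obtain a where a: "4 ^ a \<le> d" "d < 4 ^ (a + 1)"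
      using ex_power_ivl1[of 4 d] by auto
    have "(4 :: nat) ^ (a0 + 1) < 4 ^ (a + 1)"
      using d a by linarith
    \<comment> \<open>Strictness gives \<open>a \<ge> 1\<close>, so that \<open>n = 2 ^ a\<close> is
      even.\<close>
    then have a0: "a0 < a"
      by simp
    define n :: nat where "n = 2 ^ a"
    have n: "n > 0" "even n" "n * n \<le> d" "2 * 2 ^ (a - 1) = n"
      using a a0 by (auto simp: n_def power_mult_distrib[symmetric] power_Suc[symmetric] simp del: power_Suc)
    have "d < (2 * n)\<^sup>2"
      using a(2) by (simp add: n_def power2_eq_square power_mult_distrib[symmetric])
    then have "real d < (2 * real n)\<^sup>2"
      by (metis of_nat_less_iff of_nat_mult of_nat_numeral of_nat_power)
    then have sqrt_d: "sqrt (real d) < 2 * real n"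
      by (intro real_less_lsqrt) auto
    let ?P = "tensor_point n ` Pow {..<n}"
    have "\<exists>Q\<subseteq>?P. card Q = r \<and> (\<exists>c. \<forall>x\<in>Q. col x = c) \<and> (\<forall>x\<in>Q. \<forall>y\<in>Q. x \<noteq> y \<longrightarrow> edist d x y = 1)"
      if k: "real k < (1 + \<epsilon>) powr sqrt (real d)" and col: "col ` ?P \<subseteq> {..<k}"
      for k :: nat and col :: "(nat \<Rightarrow> real) \<Rightarrow> nat"
    proof -
      note k
      also have "(1 + \<epsilon>) powr sqrt (real d) \<le> (1 + \<epsilon>) powr real (2 * n)"
        using sqrt_d \<epsilon> by (intro powr_mono) auto
      also have "\<dots> = (1 / c) ^ n"
        using \<epsilon> by (simp add: powr_realpow power_mult del: of_nat_mult)
      finally have "real k * (2 * c) ^ n < (1 / c) ^ n * (2 * c) ^ n"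
        using c by (intro mult_strict_right_mono) auto
      also have "\<dots> = (1 / c * (2 * c)) ^ n"
        by (rule power_mult_distrib[symmetric])
      also have "\<dots> = 2 ^ n"
        using c by simp
      finally have "real k * (2 * c) ^ n < real (card (Pow {..<n}))"
        by (simp add: card_Pow)
      moreover have "(\<lambda>A. col (tensor_point n A)) ` Pow {..<n} \<subseteq> {..<k}"
        using col by auto
      ultimately obtain i
        where "(2 * c) ^ n \<le> real (card {A \<in> Pow {..<n}. col (tensor_point n A) = i})"
        using exists_large_color_class[of "\<lambda>A. col (tensor_point n A)" "Pow {..<n}" k "(2 * c) ^ n"]
        by auto
      then obtain Q where Q: "Q \<subseteq> {A \<in> Pow {..<n}. col (tensor_point n A) = i}" "card Q = r"
        "half_distant (2 ^ (a - 1)) Q"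
        using clique[rule_format, of a "{A \<in> Pow {..<n}. col (tensor_point n A) = i}"] a0
        unfolding n_def by auto
      have dist: "edist d (tensor_point n A) (tensor_point n B) = 1"
        if "A \<in> Q" "B \<in> Q" "A \<noteq> B" for A B
        using that Q n by (intro edist_tensor_point_half) (auto simp: pairwise_def)
      \<comment> \<open>Complementary sets share a tensor point, so injectivity is claimed only on
        \<open>Q\<close>, where distinct sets yield points at distance 1.\<close>
      have "inj_on (tensor_point n) Q"
      proof (rule inj_onI, rule ccontr)
        fix A B assume "A \<in> Q" "B \<in> Q" "tensor_point n A = tensor_point n B" "A \<noteq> B"
        then show False
          using dist[of A B] by (simp add: edist_def L2_set_def)
      qed
      then have "card (tensor_point n ` Q) = r"
        using Q by (simp add: card_image)
      moreover have "tensor_point n ` Q \<subseteq> ?P" "\<forall>x\<in>tensor_point n ` Q. col x = i"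
        using Q by auto
      moreover have "\<forall>x\<in>tensor_point n ` Q. \<forall>y\<in>tensor_point n ` Q. x \<noteq> y \<longrightarrow> edist d x y = 1"
        using dist by auto
      ultimately show ?thesis
        by blast
    qed
    moreover have "?P \<subseteq> topspace (Euclidean_space d)"
      using n by (auto simp: topspace_Euclidean_space tensor_point_def)
    ultimately show ?thesis
      using ediameter_tensor_points[OF n(1-3)] by (intro exI[of _ ?P]) auto
  qed
  with \<epsilon>(1) show "\<exists>\<epsilon>::real. \<epsilon> > 0 \<and> (\<exists>d0::nat. \<forall>d::nat. d \<ge> d0 \<longrightarrow>
      (\<exists>P :: (nat \<Rightarrow> real) set.
         P \<subseteq> topspace (Euclidean_space d) \<and> finite P \<and> P \<noteq> {} \<and> ediameter d P = 1 \<and>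
         (\<forall>(k::nat) (col :: (nat \<Rightarrow> real) \<Rightarrow> nat).
            real k < (1 + \<epsilon>) powr sqrt (real d) \<and> col ` P \<subseteq> {..<k} \<longrightarrow>
            (\<exists>Q. Q \<subseteq> P \<and> card Q = r \<and> (\<exists>c. \<forall>x\<in>Q. col x = c) \<and>
               (\<forall>x\<in>Q. \<forall>y\<in>Q. x \<noteq> y \<longrightarrow> edist d x y = 1)))))"
    by blast
qed

end
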